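(* Let $a_1^p,\dots,a_{n_p}^p$ and $a_1^u,\dots,a_{n_u}^u$ be vectors in $\mathbb{R}^d$, and for $x\in\mathbb{R}^d$ let $$h(x)=\frac1{n_p}\sum_{i=1}^{n_p}\sigma(x^\top a_i^p)-\frac1{n_u}\sum_{i=1}^{n_u}\sigma(x^\top a_i^u),\qquad g(x)=|h(x)|-\kappa,$$ where $\sigma(z)=e^z/(1+e^z)$ and $\kappa$ is the level parameter of the constraint. Let $\alpha=\frac1{4n_p}\sum_{i=1}^{n_p}\|a_i^p\|+\frac1{4n_u}\sum_{i=1}^{n_u}\|a_i^u\|$, $\beta=\frac1{4n_p}\sum_{i=1}^{n_p}\|a_i^p\|^2+\frac1{4n_u}\sum_{i=1}^{n_u}\|a_i^u\|^2$, and $\rho=\max\{2\lambda,\beta\}$, where $\lambda$ is a given regularization parameter. Suppose the first coordinates satisfy $[a_i^p]_1=1$ for $i=1,\dots,n_p$ and $[a_i^u]_1=-1$ for $i=1,\dots,n_u$, and $$\kappa\notin\mathcal{K}:=\left\{\left|\frac{i}{n_p}-\frac{j}{n_u}\right|\ :\ i=0,1,\dots,n_p,\ j=0,1,\dots,n_u\right\}.$$ Then the following hold. 1. There exist $\overline\kappa$ and $\underline\kappa$ in $\mathcal{K}$ such that the open interval $(\underline\kappa,\overline\kappa)$ contains $\kappa$ but no element of $\mathcal{K}$. 2. With these $\underline\kappa,\overline\kappa$, $$\underline q:=\inf\big\{q(x)\ :\ |h(x)|\in[(\kappa+\underline\kappa)/2,(\kappa+\overline\kappa)/2]\big\}>0,$$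 where $$q(x)=\max\left\{\max_{i=1,\dots,n_p}\frac{\sigma(x^\top a_i^p)(1-\sigma(x^\top a_i^p))}{n_p},\ \max_{i=1,\dots,n_u}\frac{\sigma(x^\top a_i^u)(1-\sigma(x^\top a_i^u))}{n_u}\right\}.$$ 3. For any $\bar\rho>\rho$ and any $\bar\epsilon>0$ with $$\bar\epsilon^2\le\min\left\{\frac{\overline\kappa-\kappa}2,\ \frac{\underline q^2}{4(\beta+\bar\rho)},\ \frac{\underline q^2\kappa}{16\alpha^2}\right\},$$ setting $$\theta:=\min\left\{\frac{\kappa-\underline\kappa}2,\ \frac{\underline q^2}{4(\beta+\bar\rho)},\ \frac{\underline q^2\kappa}{16\alpha^2}\right\},$$ one has: for every $x\in\mathbb{R}^d$ with $g(x)\le\bar\epsilon^2$ there exists $y\in\mathbb{R}^d$ with $g(y)+\frac{\bar\rho}2\|y-x\|^2\le-\theta$.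
   Context: $\|\cdot\|$ is the Euclidean norm. The setting is the fair classification problem $\min_{x\in\mathbb{R}^d}L(x)+\lambda\,\mathrm{SCAD}(x)$ subject to $g(x)\le0$, i.e. $|h(x)|\le\kappa$ (a demographic parity constraint), where $a_i^p$ and $a_i^u$ are feature vectors of the protected and unprotected groups, $L$ is a convex empirical loss, and SCAD (smoothly clipped absolute deviation) is a $2$-weakly convex regularizer; $\rho=\max\{2\lambda,\beta\}$ is a common weak-convexity constant of objective and constraint. The conclusion of item 3 is the "uniform Slater's condition" for this problem with parameters $\bar\epsilon,\theta,\bar\rho$.
   Formalization: The formal statement assumes that the level parameter κ satisfies 0 ≤ κ ≤ 1; outside this range item 1 fails (e.g. κ = 2, since every element of K lies in [0,1]), and items 2 and 3 refer to the κ-bounds of item 1. *)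

theory Defs
  imports "HOL-Analysis.Analysis"
begin

(* A group of n feature vectors is a family a :: nat => real^'d of which only the entries
   a 1, ..., a n are used.  The index type 'd carries a linear order, so that vectors have a
   first coordinate: the one at the least index. *)

definition first_coord :: "real ^ 'd::{finite,linorder} \<Rightarrow> real" where
  "first_coord v = v $ Min UNIV"

definition sigmoid :: "real \<Rightarrow> real" where
  "sigmoid z = exp z / (1 + exp z)"

definition h_fun :: "nat \<Rightarrow> (nat \<Rightarrow> real ^ 'd::finite) \<Rightarrow> nat \<Rightarrow> (nat \<Rightarrow> real ^ 'd) \<Rightarrow> real ^ 'd \<Rightarrow> real" where
  "h_fun np ap nu au x =
     1 / real np * (\<Sum>i=1..np. sigmoid (x \<bullet> ap i)) - 1 / real nu * (\<Sum>i=1..nu. sigmoid (x \<bullet> au i))"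

definition g_fun :: "nat \<Rightarrow> (nat \<Rightarrow> real ^ 'd::finite) \<Rightarrow> nat \<Rightarrow> (nat \<Rightarrow> real ^ 'd) \<Rightarrow> real \<Rightarrow> real ^ 'd \<Rightarrow> real" where
  "g_fun np ap nu au \<kappa> x = \<bar>h_fun np ap nu au x\<bar> - \<kappa>"

definition alpha_const :: "nat \<Rightarrow> (nat \<Rightarrow> real ^ 'd::finite) \<Rightarrow> nat \<Rightarrow> (nat \<Rightarrow> real ^ 'd) \<Rightarrow> real" where
  "alpha_const np ap nu au =
     1 / (4 * real np) * (\<Sum>i=1..np. norm (ap i)) + 1 / (4 * real nu) * (\<Sum>i=1..nu. norm (au i))"

definition beta_const :: "nat \<Rightarrow> (nat \<Rightarrow> real ^ 'd::finite) \<Rightarrow> nat \<Rightarrow> (nat \<Rightarrow> real ^ 'd) \<Rightarrow> real" where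
  "beta_const np ap nu au =
     1 / (4 * real np) * (\<Sum>i=1..np. (norm (ap i))\<^sup>2) + 1 / (4 * real nu) * (\<Sum>i=1..nu. (norm (au i))\<^sup>2)"

definition rho_const :: "nat \<Rightarrow> (nat \<Rightarrow> real ^ 'd::finite) \<Rightarrow> nat \<Rightarrow> (nat \<Rightarrow> real ^ 'd) \<Rightarrow> real \<Rightarrow> real" where
  "rho_const np ap nu au lam = max (2 * lam) (beta_const np ap nu au)"

definition K_set :: "nat \<Rightarrow> nat \<Rightarrow> real set" where
  "K_set np nu = {\<bar>real i / real np - real j / real nu\<bar> | i j. i \<in> {0..np} \<and> j \<in> {0..nu}}"

definition q_fun :: "nat \<Rightarrow> (nat \<Rightarrow> real ^ 'd::finite) \<Rightarrow> nat \<Rightarrow> (nat \<Rightarrow> real ^ 'd) \<Rightarrow> real ^ 'd \<Rightarrow> real" where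
  "q_fun np ap nu au x =
     max (MAX i\<in>{1..np}. sigmoid (x \<bullet> ap i) * (1 - sigmoid (x \<bullet> ap i)) / real np)
         (MAX i\<in>{1..nu}. sigmoid (x \<bullet> au i) * (1 - sigmoid (x \<bullet> au i)) / real nu)"

(* The set below is nonempty under the hypotheses on the first coordinates if kl, kappa, ku
   are as in the theorem, and q_fun is nonnegative, so the real-valued infimum is the genuine one. *)
definition q_inf :: "nat \<Rightarrow> (nat \<Rightarrow> real ^ 'd::finite) \<Rightarrow> nat \<Rightarrow> (nat \<Rightarrow> real ^ 'd) \<Rightarrow> real \<Rightarrow> real \<Rightarrow> real \<Rightarrow> real" where
  "q_inf np ap nu au \<kappa> kl ku =
     Inf {q_fun np ap nu au x | x. \<bar>h_fun np ap nu au x\<bar> \<in> {(\<kappa> + kl) / 2 .. (\<kappa> + ku) / 2}}"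

definition K_gap :: "nat \<Rightarrow> nat \<Rightarrow> real \<Rightarrow> real \<Rightarrow> real \<Rightarrow> bool" where
  "K_gap np nu \<kappa> kl ku \<longleftrightarrow>
     kl \<in> K_set np nu \<and> ku \<in> K_set np nu \<and> \<kappa> \<in> {kl<..<ku} \<and> {kl<..<ku} \<inter> K_set np nu = {}"

end

theory Submission
  imports Defs
begin

text \<open>
  Moving along the first basis vector shifts all the arguments of the sigmoids of one group by the
  same amount, and those of the other group by its negative, so that all the summands of \<open>h\<close> move
  in the same direction, at a total rate of at least \<open>q\<close>.  If \<open>q x\<close> is small, then every sigmoid
  value is nearly 0 or 1, and \<open>\<bar>h x\<bar>\<close> is near an element of \<open>K\<close>; this gives the lower bound on \<open>q\<close>.
  For the uniform Slater condition, either \<open>x\<close> itself is far enough inside the feasible set, or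
  \<open>q x\<close> is at least its infimum and a step of length
  \<open>t = min (q / (\<beta> + \<rho>)) (\<kappa> / (2 \<alpha>))\<close> along that vector decreases \<open>\<bar>h\<bar>\<close> enough, the second bound
  on \<open>t\<close> preventing a change of the sign of \<open>h\<close>.
\<close>

section \<open>Estimates for the logistic function\<close>

lemma sigmoid_pos: "0 < sigmoid z"
  by (simp add: sigmoid_def add_pos_pos)

lemma sigmoid_less_1: "sigmoid z < 1"
  by (simp add: sigmoid_def add_pos_pos divide_simps)

lemma sigmoid_uminus: "sigmoid (- z) = 1 - sigmoid z"
proof -
  have "1 + exp z \<noteq> 0"
    using exp_gt_zero[of z] by linarith
  then show ?thesis
    by (simp add: sigmoid_def exp_minus field_simps)
qed

lemma sigmoid_logit:
  assumes "0 < p" "p < 1"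
  shows "sigmoid (ln (p / (1 - p))) = p"
  using assms by (simp add: sigmoid_def field_simps)

lemma has_real_derivative_sigmoid:
  "(sigmoid has_real_derivative sigmoid z * (1 - sigmoid z)) (at z)"
proof -
  have nz: "1 + exp z \<noteq> 0"
    using exp_gt_zero[of z] by linarith
  have "((\<lambda>z. exp z / (1 + exp z)) has_real_derivative
         exp z / (1 + exp z) * (1 - exp z / (1 + exp z))) (at z)"
    using nz by (auto intro!: derivative_eq_intros simp: field_simps)
  then show ?thesis
    by (simp add: sigmoid_def[abs_def])
qed

lemma sigmoid_deriv_pos: "0 < sigmoid z * (1 - sigmoid z)"
  by (simp add: sigmoid_pos sigmoid_less_1)

lemma mult_one_minus_le: "s * (1 - s) \<le> 1 / 4" for s :: real
  using zero_le_power2[of "s - 1 / 2"] by (simp add: power2_eq_square algebra_simps)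

text \<open>Lagrange remainder: with s the sigmoid value, the second derivative s (1 - s) (1 - 2 s)
  is at most 1/4 in absolute value, since s (1 - s) \<le> 1/4 and 1 - 2 s lies between -1 and
  1.\<close>

lemma sigmoid_taylor:
  "\<bar>sigmoid w - sigmoid z - sigmoid z * (1 - sigmoid z) * (w - z)\<bar> \<le> (w - z)\<^sup>2 / 8"
proof (cases "w = z")
  case False
  \<comment> \<open>The table of derivatives is read only at the orders 0, 1 and 2, so its last
    branch can be the second derivative for every other order.\<close>
  define diff where "diff m z = (if m = 0 then sigmoid z else if m = 1 then sigmoid z * (1 - sigmoid z)
    else sigmoid z * (1 - sigmoid z) * (1 - 2 * sigmoid z))" for m :: nat and z
  have "(diff m has_real_derivative diff (Suc m) t) (at t)" if "m < 2" for m t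
  proof (cases "m = 0")
    case True
    then show ?thesis
      using has_real_derivative_sigmoid by (simp add: diff_def[abs_def])
  next
    case False
    then have m: "m = 1" using that by simp
    have "((\<lambda>z. sigmoid z * (1 - sigmoid z)) has_real_derivative
        sigmoid t * (1 - sigmoid t) * (1 - 2 * sigmoid t)) (at t)"
      by (auto intro!: derivative_eq_intros has_real_derivative_sigmoid simp: algebra_simps)
    then show ?thesis
      by (simp add: diff_def[abs_def] m)
  qed
  \<comment> \<open>\<open>Taylor\<close> asks for two distinct points, hence the case split on
    \<open>w = z\<close>; the interval from \<open>min w z\<close> to \<open>max w z\<close> covers
    both orders of the points.\<close>
  then obtain t where
    t: "sigmoid w = (\<Sum>m<2. diff m z / fact m * (w - z) ^ m) + diff 2 t / fact 2 * (w - z) ^ 2"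
    using Taylor[of 2 diff sigmoid "min w z" "max w z" z w] False
    by (auto simp: diff_def[abs_def])
  have "\<bar>diff 2 t\<bar> = sigmoid t * (1 - sigmoid t) * \<bar>1 - 2 * sigmoid t\<bar>"
    using sigmoid_pos[of t] sigmoid_less_1[of t] by (simp add: diff_def abs_mult)
  also have "\<dots> \<le> 1 / 4 * 1"
    using sigmoid_pos[of t] sigmoid_less_1[of t]
    by (intro mult_mono mult_one_minus_le) auto
  finally have "\<bar>diff 2 t / fact 2 * (w - z) ^ 2\<bar> \<le> 1 / 8 * (w - z)\<^sup>2"
    unfolding abs_mult by (intro mult_mono) auto
  moreover have "sigmoid w - sigmoid z - sigmoid z * (1 - sigmoid z) * (w - z)
      = diff 2 t / fact 2 * (w - z) ^ 2"
    using t by (simp add: diff_def numeral_2_eq_2)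
  ultimately show ?thesis
    by linarith
qed simp

lemma sigmoid_lipschitz: "\<bar>sigmoid w - sigmoid z\<bar> \<le> \<bar>w - z\<bar> / 4"
proof -
  have "\<bar>sigmoid z * (1 - sigmoid z)\<bar> \<le> 1 / 4" for z
    using mult_one_minus_le[of "sigmoid z"] sigmoid_deriv_pos[of z] by linarith
  then have "norm (sigmoid w - sigmoid z) \<le> 1 / 4 * norm (w - z)"
    by (intro field_differentiable_bound[where S = UNIV])
       (auto intro: has_field_derivative_at_within has_real_derivative_sigmoid)
  then show ?thesis by simp
qed

text \<open>One of the factors s and 1 - s is at least 1/2, and the other is the distance from s to
  its rounding \<open>of_bool (s > 1 / 2)\<close>.\<close>

lemma near_0_or_1:
  fixes s :: real
  assumes "0 < s" "s < 1"
  shows "\<bar>s - of_bool (s > 1 / 2)\<bar> \<le> 2 * (s * (1 - s))"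
proof (cases "s > 1 / 2")
  case True
  then have "(1 - s) * 1 \<le> (1 - s) * (2 * s)"
    using assms by (intro mult_left_mono) auto
  then show ?thesis using True assms by (simp add: algebra_simps)
next
  case False
  then have "s * 1 \<le> s * (2 * (1 - s))"
    using assms by (intro mult_left_mono) auto
  then show ?thesis using False assms by (simp add: algebra_simps)
qed

section \<open>Symmetry of h and q, and bounds on q\<close>

lemma h_fun_uminus:
  assumes "np \<ge> 1" "nu \<ge> 1"
  shows "h_fun np ap nu au (- x) = - h_fun np ap nu au x"
  \<comment> \<open>Each of the two averages A turns into 1 - A, because the groups are nonempty,
    and the two ones cancel.\<close>
  using assms by (simp add: h_fun_def sigmoid_uminus sum_subtractf field_simps)

lemma q_fun_uminus: "q_fun np ap nu au (- x) = q_fun np ap nu au x"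
  by (simp add: q_fun_def sigmoid_uminus mult.commute)

lemma q_fun_ge:
  assumes "i \<in> {1..np}"
  shows "sigmoid (x \<bullet> ap i) * (1 - sigmoid (x \<bullet> ap i)) / real np \<le> q_fun np ap nu au x"
  unfolding q_fun_def using assms by (intro max.coboundedI1 Max_ge) auto

lemma q_fun_ge':
  assumes "i \<in> {1..nu}"
  shows "sigmoid (x \<bullet> au i) * (1 - sigmoid (x \<bullet> au i)) / real nu \<le> q_fun np ap nu au x"
  unfolding q_fun_def using assms by (intro max.coboundedI2 Max_ge) auto

lemma q_fun_nonneg:
  assumes "np \<ge> 1"
  shows "0 \<le> q_fun np ap nu au x"
proof -
  have "0 \<le> sigmoid (x \<bullet> ap 1) * (1 - sigmoid (x \<bullet> ap 1)) / real np"
    using sigmoid_deriv_pos[of "x \<bullet> ap 1"] by simp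
  also have "\<dots> \<le> q_fun np ap nu au x"
    using assms by (intro q_fun_ge) auto
  finally show ?thesis .
qed

text \<open>A maximum of nonnegative numbers is at most their sum. The sum on the right is the rate
  at which h decreases along the shift used later, so q bounds that rate from below.\<close>

lemma q_fun_le:
  assumes "np \<ge> 1" "nu \<ge> 1"
  shows "q_fun np ap nu au x \<le>
    (\<Sum>i=1..np. sigmoid (x \<bullet> ap i) * (1 - sigmoid (x \<bullet> ap i))) / np +
    (\<Sum>i=1..nu. sigmoid (x \<bullet> au i) * (1 - sigmoid (x \<bullet> au i))) / nu" (is "_ \<le> ?P / _ + ?U / _")
proof -
  have member: "sigmoid (x \<bullet> a i) * (1 - sigmoid (x \<bullet> a i)) / n
      \<le> (\<Sum>i=1..n. sigmoid (x \<bullet> a i) * (1 - sigmoid (x \<bullet> a i))) / n"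
    if "i \<in> {1..n}" for i n and a :: "nat \<Rightarrow> real ^ 'a"
    using that sigmoid_deriv_pos
    by (intro divide_right_mono member_le_sum) (auto intro: less_imp_le)
  have nonneg: "0 \<le> (\<Sum>i=1..n. sigmoid (x \<bullet> a i) * (1 - sigmoid (x \<bullet> a i))) / n"
    for n and a :: "nat \<Rightarrow> real ^ 'a"
    using sigmoid_deriv_pos by (intro divide_nonneg_nonneg sum_nonneg) (auto intro: less_imp_le)
  have "(MAX i\<in>{1..np}. sigmoid (x \<bullet> ap i) * (1 - sigmoid (x \<bullet> ap i)) / real np) \<le> ?P / np"
    using assms member[of _ np ap] by (subst Max_le_iff) auto
  moreover have "(MAX i\<in>{1..nu}. sigmoid (x \<bullet> au i) * (1 - sigmoid (x \<bullet> au i)) / real nu) \<le> ?U / nu"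
    using assms member[of _ nu au] by (subst Max_le_iff) auto
  ultimately show ?thesis
    unfolding q_fun_def using nonneg[where n = np and a = ap] nonneg[where n = nu and a = au] by linarith
qed

section \<open>Small q forces the absolute value of h to be near K\<close>

lemma sigmoid_average_near:
  fixes a :: "nat \<Rightarrow> real ^ 'd::finite"
  assumes "n \<ge> 1"
    and q: "\<And>i. i \<in> {1..n} \<Longrightarrow> sigmoid (x \<bullet> a i) * (1 - sigmoid (x \<bullet> a i)) / real n \<le> q"
  obtains k :: nat where "k \<in> {0..n}" "\<bar>1 / real n * (\<Sum>i=1..n. sigmoid (x \<bullet> a i)) - k / n\<bar> \<le> 2 * real n * q"
proof -
  define s where "s i = sigmoid (x \<bullet> a i)" for i
  \<comment> \<open>Rounding every sigmoid value to 0 or 1 turns the average into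
    \<open>k / n\<close>; the bound \<open>q\<close> limits each rounding error to
    \<open>2 * (n * q)\<close>.\<close>
  define k where "k = card {i \<in> {1..n}. s i > 1 / 2}"
  have "k \<le> card {1..n}"
    unfolding k_def by (intro card_mono) auto
  then have "k \<in> {0..n}" by simp
  have "real k = (\<Sum>i=1..n. of_bool (s i > 1 / 2))"
    by (simp add: k_def Int_def)
  then have "\<bar>(\<Sum>i=1..n. s i) - k\<bar> = \<bar>\<Sum>i=1..n. s i - of_bool (s i > 1 / 2)\<bar>"
    by (simp add: sum_subtractf)
  also have "\<dots> \<le> (\<Sum>i=1..n. \<bar>s i - of_bool (s i > 1 / 2)\<bar>)"
    by (rule sum_abs)
  also have "\<dots> \<le> (\<Sum>i=1..n. 2 * (n * q))"
  proof (rule sum_mono)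
    fix i assume "i \<in> {1..n}"
    then have "s i * (1 - s i) \<le> n * q"
      using q[of i] assms(1) by (simp add: s_def field_simps)
    then show "\<bar>s i - of_bool (s i > 1 / 2)\<bar> \<le> 2 * (n * q)"
      using near_0_or_1[of "s i"] sigmoid_pos sigmoid_less_1 by (simp add: s_def)
  qed
  finally have "\<bar>(\<Sum>i=1..n. s i) - k\<bar> \<le> n * (2 * real n * q)"
    by simp
  then have "\<bar>(\<Sum>i=1..n. s i) - k\<bar> / n \<le> 2 * real n * q"
    using assms(1) by (simp add: field_simps)
  moreover have "\<bar>(\<Sum>i=1..n. s i) - k\<bar> / n = \<bar>1 / n * (\<Sum>i=1..n. s i) - k / n\<bar>"
    by (simp flip: diff_divide_distrib)
  ultimately show ?thesis
    using that \<open>k \<in> {0..n}\<close> by (simp add: s_def)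
qed

text \<open>Both averages are rounded separately and the errors add up; taking absolute values of h
  and of the rounded difference does not increase their distance.\<close>

lemma h_fun_near_K_set:
  assumes "np \<ge> 1" "nu \<ge> 1"
  obtains k where "k \<in> K_set np nu"
    "\<bar>\<bar>h_fun np ap nu au x\<bar> - k\<bar> \<le> 2 * (real np + real nu) * q_fun np ap nu au x"
proof -
  let ?q = "q_fun np ap nu au x"
  obtain i where i: "i \<in> {0..np}"
    "\<bar>1 / real np * (\<Sum>i=1..np. sigmoid (x \<bullet> ap i)) - i / np\<bar> \<le> 2 * real np * ?q"
    by (rule sigmoid_average_near[OF assms(1), of x ap ?q]) (blast intro: q_fun_ge)+
  obtain j where j: "j \<in> {0..nu}"
    "\<bar>1 / real nu * (\<Sum>i=1..nu. sigmoid (x \<bullet> au i)) - j / nu\<bar> \<le> 2 * real nu * ?q"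
    by (rule sigmoid_average_near[OF assms(2), of x au ?q]) (blast intro: q_fun_ge')+
  have "\<bar>real i / np - real j / nu\<bar> \<in> K_set np nu"
    using i(1) j(1) unfolding K_set_def by blast
  moreover have "\<bar>\<bar>h_fun np ap nu au x\<bar> - \<bar>real i / np - real j / nu\<bar>\<bar> \<le> 2 * (real np + real nu) * ?q"
    using i(2) j(2) unfolding h_fun_def ring_distribs by linarith
  ultimately show ?thesis by (rule that)
qed

section \<open>The set K and its gaps\<close>

lemma finite_K_set: "finite (K_set np nu)"
proof -
  have "K_set np nu = (\<lambda>(i, j). \<bar>real i / real np - real j / real nu\<bar>) ` ({0..np} \<times> {0..nu})"
    unfolding K_set_def by fast
  then show ?thesis by simp
qed

lemma K_set_0: "0 \<in> K_set np nu"
  unfolding K_set_def by (force intro!: exI[of _ 0])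

lemma K_set_1:
  assumes "np \<ge> 1"
  shows "1 \<in> K_set np nu"
proof -
  have "1 = \<bar>real np / real np - real 0 / real nu\<bar>"
    using assms by simp
  then show ?thesis
    unfolding K_set_def by fastforce
qed

lemma K_set_bounds:
  assumes "k \<in> K_set np nu"
  shows "0 \<le> k" "k \<le> 1"
proof -
  obtain i j where k: "k = \<bar>real i / np - real j / nu\<bar>" and ij: "i \<le> np" "j \<le> nu"
    using assms by (auto simp: K_set_def)
  have "0 \<le> real i / np" "real i / np \<le> 1" "0 \<le> real j / nu" "real j / nu \<le> 1"
    using ij by (auto simp: divide_simps)
  then show "0 \<le> k" "k \<le> 1"
    unfolding k by linarith+
qed

text \<open>The ends of the gap are the two neighbours of \<kappa> in the finite set K. Both exist
  because 0 and 1 belong to K, and \<kappa>, which does not, lies strictly between them.\<close>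

lemma K_gap_exists:
  assumes "np \<ge> 1" "0 \<le> \<kappa>" "\<kappa> \<le> 1" "\<kappa> \<notin> K_set np nu"
  shows "\<exists>kl ku. K_gap np nu \<kappa> kl ku"
proof -
  let ?L = "{k \<in> K_set np nu. k < \<kappa>}" and ?U = "{k \<in> K_set np nu. \<kappa> < k}"
  have fin: "finite ?L" "finite ?U"
    using finite_K_set by simp_all
  have "\<kappa> \<noteq> 0" "\<kappa> \<noteq> 1"
    using assms(4) K_set_0 K_set_1[OF assms(1)] by auto
  then have "0 \<in> ?L" "1 \<in> ?U"
    using K_set_0 K_set_1[OF assms(1)] assms by auto
  then have ne: "?L \<noteq> {}" "?U \<noteq> {}"
    by blast+
  have L: "Max ?L \<in> ?L" and U: "Min ?U \<in> ?U"
    using Max_in[OF fin(1) ne(1)] Min_in[OF fin(2) ne(2)] by blast+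
  have "k \<notin> {Max ?L<..<Min ?U}" if "k \<in> K_set np nu" for k
  proof (cases "k < \<kappa>")
    case True
    then show ?thesis using Max_ge[OF fin(1), of k] that by auto
  next
    case False
    then have "k \<in> ?U" using assms(4) that by (cases "k = \<kappa>") auto
    then show ?thesis using Min_le[OF fin(2), of k] by auto
  qed
  then have "K_gap np nu \<kappa> (Max ?L) (Min ?U)"
    using L U unfolding K_gap_def by auto
  then show ?thesis by blast
qed

text \<open>The factor 1/4 matches the normalization of the two sums in \<open>alpha_const\<close>
  and \<open>beta_const\<close>.\<close>

lemma average_ge:
  fixes f :: "nat \<Rightarrow> real"
  assumes "n \<ge> 1" "\<And>i. i \<in> {1..n} \<Longrightarrow> c \<le> f i"
  shows "c / 4 \<le> 1 / (4 * real n) * (\<Sum>i=1..n. f i)"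
proof -
  have "real n * c \<le> (\<Sum>i=1..n. f i)"
    using sum_bounded_below[of "{1..n}" c f] assms(2) by simp
  then show ?thesis
    using assms(1) by (simp add: field_simps)
qed

lemma average_le:
  fixes f :: "nat \<Rightarrow> real"
  assumes "n \<ge> 1" "\<And>i. i \<in> {1..n} \<Longrightarrow> f i \<le> c"
  shows "1 / real n * (\<Sum>i=1..n. f i) \<le> c"
proof -
  have "(\<Sum>i=1..n. f i) \<le> real n * c"
    using sum_bounded_above[of "{1..n}" f c] assms(2) by simp
  then show ?thesis
    using assms(1) by (simp add: field_simps)
qed

section \<open>Moving along a unit vector with inner product 1 with one group and -1 with the
  other\<close>

context
  fixes ap au :: "nat \<Rightarrow> real ^ 'd::finite" and np nu :: nat and e :: "real ^ 'd"
  assumes np: "np \<ge> 1" and nu: "nu \<ge> 1" and norm_e: "norm e = 1"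
    and ap: "\<forall>i\<in>{1..np}. e \<bullet> ap i = 1"
    and au: "\<forall>i\<in>{1..nu}. e \<bullet> au i = -1"
begin

lemma norm_ap_ge: "i \<in> {1..np} \<Longrightarrow> 1 \<le> norm (ap i)"
  using Cauchy_Schwarz_ineq2[of e "ap i"] by (simp add: ap norm_e)

lemma norm_au_ge: "i \<in> {1..nu} \<Longrightarrow> 1 \<le> norm (au i)"
  using Cauchy_Schwarz_ineq2[of e "au i"] by (simp add: au norm_e)

text \<open>By Cauchy-Schwarz with \<open>e\<close> all feature vectors have norm at least 1, so
  each group contributes at least 1/4. This and \<open>beta_const_ge\<close> let \<alpha> and
  \<beta> dominate the constants 1/2 that govern h along \<open>e\<close>: the drop
  \<open>t / 2\<close> is at most \<alpha> t, and the error \<open>t\<^sup>2 / 4\<close> is at most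
  half of \<beta> \<open>t\<^sup>2\<close>.\<close>

lemma alpha_const_ge: "1 / 2 \<le> alpha_const np ap nu au"
proof -
  have "1 / 4 \<le> 1 / (4 * real np) * (\<Sum>i=1..np. norm (ap i))"
    by (intro average_ge np norm_ap_ge)
  moreover have "1 / 4 \<le> 1 / (4 * real nu) * (\<Sum>i=1..nu. norm (au i))"
    by (intro average_ge nu norm_au_ge)
  ultimately show ?thesis
    unfolding alpha_const_def by linarith
qed

lemma beta_const_ge: "1 / 2 \<le> beta_const np ap nu au"
proof -
  have "1 / 4 \<le> 1 / (4 * real np) * (\<Sum>i=1..np. (norm (ap i))\<^sup>2)"
    by (intro average_ge np one_le_power norm_ap_ge)
  moreover have "1 / 4 \<le> 1 / (4 * real nu) * (\<Sum>i=1..nu. (norm (au i))\<^sup>2)"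
    by (intro average_ge nu one_le_power norm_au_ge)
  ultimately show ?thesis
    unfolding beta_const_def by linarith
qed

lemma q_fun_le_half: "q_fun np ap nu au x \<le> 1 / 2"
proof -
  have "1 / real np * (\<Sum>i=1..np. sigmoid (x \<bullet> ap i) * (1 - sigmoid (x \<bullet> ap i))) \<le> 1 / 4"
    "1 / real nu * (\<Sum>i=1..nu. sigmoid (x \<bullet> au i) * (1 - sigmoid (x \<bullet> au i))) \<le> 1 / 4"
    by (intro average_le np nu mult_one_minus_le)+
  then show ?thesis
    using q_fun_le[OF np nu, of ap au x] unfolding times_divide_eq_left mult_1_left by linarith
qed

text \<open>The step lowers the arguments of the first group by t and raises those of the second, so
  to first order every term of h decreases. The Taylor error is \<open>t\<^sup>2 / 8\<close> for
  each group average.\<close>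

lemma h_fun_descent:
  assumes "t \<ge> 0"
  shows "h_fun np ap nu au (x - t *\<^sub>R e) \<le> h_fun np ap nu au x - q_fun np ap nu au x * t + t\<^sup>2 / 4"
proof -
  let ?s' = "\<lambda>z. sigmoid z * (1 - sigmoid z)"
  have "1 / real np * (\<Sum>i=1..np. sigmoid ((x - t *\<^sub>R e) \<bullet> ap i) - sigmoid (x \<bullet> ap i)
      + ?s' (x \<bullet> ap i) * t) \<le> t\<^sup>2 / 8"
  proof (rule average_le[OF np])
    fix i assume "i \<in> {1..np}"
    then show "sigmoid ((x - t *\<^sub>R e) \<bullet> ap i) - sigmoid (x \<bullet> ap i) + ?s' (x \<bullet> ap i) * t \<le> t\<^sup>2 / 8"
      using abs_le_D1[OF sigmoid_taylor[of "x \<bullet> ap i - t" "x \<bullet> ap i"]] by (simp add: ap inner_diff_left)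
  qed
  moreover have "1 / real np * (\<Sum>i=1..np. sigmoid ((x - t *\<^sub>R e) \<bullet> ap i) - sigmoid (x \<bullet> ap i)
      + ?s' (x \<bullet> ap i) * t)
    = 1 / real np * (\<Sum>i=1..np. sigmoid ((x - t *\<^sub>R e) \<bullet> ap i))
      - 1 / real np * (\<Sum>i=1..np. sigmoid (x \<bullet> ap i)) + (\<Sum>i=1..np. ?s' (x \<bullet> ap i)) / np * t"
    by (simp add: sum.distrib sum_subtractf add_divide_distrib diff_divide_distrib flip: sum_distrib_right)
  moreover have "1 / real nu * (\<Sum>i=1..nu. sigmoid (x \<bullet> au i) - sigmoid ((x - t *\<^sub>R e) \<bullet> au i)
      + ?s' (x \<bullet> au i) * t) \<le> t\<^sup>2 / 8"
  proof (rule average_le[OF nu])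
    fix i assume "i \<in> {1..nu}"
    then show "sigmoid (x \<bullet> au i) - sigmoid ((x - t *\<^sub>R e) \<bullet> au i) + ?s' (x \<bullet> au i) * t \<le> t\<^sup>2 / 8"
      \<comment> \<open>This group enters h with a minus sign, so the other half of the two-sided
        Taylor bound is needed.\<close>
      using abs_le_D2[OF sigmoid_taylor[of "x \<bullet> au i + t" "x \<bullet> au i"]] by (simp add: au inner_diff_left)
  qed
  moreover have "1 / real nu * (\<Sum>i=1..nu. sigmoid (x \<bullet> au i) - sigmoid ((x - t *\<^sub>R e) \<bullet> au i)
      + ?s' (x \<bullet> au i) * t)
    = 1 / real nu * (\<Sum>i=1..nu. sigmoid (x \<bullet> au i))
      - 1 / real nu * (\<Sum>i=1..nu. sigmoid ((x - t *\<^sub>R e) \<bullet> au i)) + (\<Sum>i=1..nu. ?s' (x \<bullet> au i)) / nu * t"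
    by (simp add: sum.distrib sum_subtractf add_divide_distrib diff_divide_distrib flip: sum_distrib_right)
  moreover have "q_fun np ap nu au x * t
    \<le> ((\<Sum>i=1..np. ?s' (x \<bullet> ap i)) / np + (\<Sum>i=1..nu. ?s' (x \<bullet> au i)) / nu) * t"
    using assms by (intro mult_right_mono q_fun_le np nu)
  ultimately show ?thesis
    unfolding h_fun_def distrib_right by linarith
qed

text \<open>Each average changes by at most t/4 by the Lipschitz bound. This is what keeps h
  nonnegative after a short step.\<close>

lemma h_fun_drop_le:
  assumes "t \<ge> 0"
  shows "h_fun np ap nu au x - t / 2 \<le> h_fun np ap nu au (x - t *\<^sub>R e)"
proof -
  have "1 / real np * (\<Sum>i=1..np. sigmoid (x \<bullet> ap i) - sigmoid ((x - t *\<^sub>R e) \<bullet> ap i)) \<le> t / 4"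
  proof (rule average_le[OF np])
    fix i assume "i \<in> {1..np}"
    then show "sigmoid (x \<bullet> ap i) - sigmoid ((x - t *\<^sub>R e) \<bullet> ap i) \<le> t / 4"
      using abs_le_D1[OF sigmoid_lipschitz[of "x \<bullet> ap i" "x \<bullet> ap i - t"]] assms by (simp add: ap inner_diff_left)
  qed
  moreover have "1 / real nu * (\<Sum>i=1..nu. sigmoid ((x - t *\<^sub>R e) \<bullet> au i) - sigmoid (x \<bullet> au i)) \<le> t / 4"
  proof (rule average_le[OF nu])
    fix i assume "i \<in> {1..nu}"
    then show "sigmoid ((x - t *\<^sub>R e) \<bullet> au i) - sigmoid (x \<bullet> au i) \<le> t / 4"
      using abs_le_D1[OF sigmoid_lipschitz[of "x \<bullet> au i + t" "x \<bullet> au i"]] assms by (simp add: au inner_diff_left)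
  qed
  ultimately show ?thesis
    unfolding h_fun_def sum_subtractf right_diff_distrib by linarith
qed

section \<open>Values of h and the infimum of q\<close>

lemma h_fun_surj:
  assumes "\<bar>v\<bar> < 1"
  obtains x where "h_fun np ap nu au x = v"
proof -
  \<comment> \<open>On the line spanned by \<open>e\<close>, h equals 2 \<open>sigmoid t\<close> -
    1, so t is the logit of \<open>(1 + v) / 2\<close>.\<close>
  define t where "t = ln ((1 + v) / 2 / (1 - (1 + v) / 2))"
  have t: "sigmoid t = (1 + v) / 2"
    unfolding t_def using assms by (intro sigmoid_logit) auto
  have "h_fun np ap nu au (t *\<^sub>R e) = sigmoid t - sigmoid (- t)"
    using np nu by (simp add: h_fun_def ap au)
  also have "\<dots> = v"
    by (simp add: sigmoid_uminus t)
  finally show ?thesis by (rule that)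
qed

text \<open>The band consists of points at distance at least half of
  \<open>min (\<kappa> - kl) (ku - \<kappa>)\<close> from all of K, whereas
  \<open>h_fun_near_K_set\<close> finds an element of K within a multiple of q.\<close>

lemma q_fun_ge_gap:
  assumes gap: "K_gap np nu \<kappa> kl ku"
    and x: "\<bar>h_fun np ap nu au x\<bar> \<in> {(\<kappa> + kl) / 2 .. (\<kappa> + ku) / 2}"
  shows "min (\<kappa> - kl) (ku - \<kappa>) / (4 * (real np + real nu)) \<le> q_fun np ap nu au x"
proof -
  obtain k where k: "k \<in> K_set np nu"
    "\<bar>\<bar>h_fun np ap nu au x\<bar> - k\<bar> \<le> 2 * (real np + real nu) * q_fun np ap nu au x"
    using h_fun_near_K_set[OF np nu] by blast
  have h: "(\<kappa> + kl) / 2 \<le> \<bar>h_fun np ap nu au x\<bar>" "\<bar>h_fun np ap nu au x\<bar> \<le> (\<kappa> + ku) / 2"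
    using x by auto
  have "k \<notin> {kl<..<ku}"
    using gap k(1) unfolding K_gap_def by blast
  then consider "k \<le> kl" | "ku \<le> k"
    by fastforce
  then have "min (\<kappa> - kl) (ku - \<kappa>) / 2 \<le> \<bar>\<bar>h_fun np ap nu au x\<bar> - k\<bar>"
    using h min.cobounded1[of "\<kappa> - kl" "ku - \<kappa>"] min.cobounded2[of "\<kappa> - kl" "ku - \<kappa>"]
      abs_ge_self[of "\<bar>h_fun np ap nu au x\<bar> - k"] abs_ge_minus_self[of "\<bar>h_fun np ap nu au x\<bar> - k"]
    by cases argo+
  also note k(2)
  finally show ?thesis
    using np by (simp add: field_simps)
qed

lemma q_inf_pos:
  assumes gap: "K_gap np nu \<kappa> kl ku"
  shows "0 < q_inf np ap nu au \<kappa> kl ku"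
proof -
  have k: "kl < \<kappa>" "\<kappa> < ku" "0 \<le> kl" "ku \<le> 1"
    using gap K_set_bounds unfolding K_gap_def by auto
  \<comment> \<open>A lower bound passes to the real infimum only for a nonempty set; \<kappa> lies
    in the band, and it is a value of h since 0 < \<kappa> < 1.\<close>
  obtain x where "h_fun np ap nu au x = \<kappa>"
    using h_fun_surj[of \<kappa>] k by auto
  then have ne: "{q_fun np ap nu au x | x. \<bar>h_fun np ap nu au x\<bar> \<in> {(\<kappa> + kl) / 2 .. (\<kappa> + ku) / 2}} \<noteq> {}"
    using k by (auto intro!: exI[of _ x])
  have "0 < min (\<kappa> - kl) (ku - \<kappa>) / (4 * (real np + real nu))"
    using k np by simp
  also have "\<dots> \<le> q_inf np ap nu au \<kappa> kl ku"
    unfolding q_inf_def using q_fun_ge_gap[OF gap] by (intro cInf_greatest[OF ne]) auto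
  finally show ?thesis .
qed

lemma q_inf_le:
  assumes "\<bar>h_fun np ap nu au x\<bar> \<in> {(\<kappa> + kl) / 2 .. (\<kappa> + ku) / 2}"
  shows "q_inf np ap nu au \<kappa> kl ku \<le> q_fun np ap nu au x"
  unfolding q_inf_def using assms q_fun_nonneg[OF np]
  by (intro cInf_lower bdd_belowI[of _ 0]) auto

section \<open>The uniform Slater condition\<close>

lemma slater_step:
  fixes q r E \<theta> :: real
  defines "\<alpha> \<equiv> alpha_const np ap nu au" and "\<beta> \<equiv> beta_const np ap nu au"
  assumes "0 < \<kappa>" "0 < r" "0 < q" "q \<le> q_fun np ap nu au x"
    and h: "\<kappa> / 2 \<le> h_fun np ap nu au x" "h_fun np ap nu au x \<le> \<kappa> + E"
    and E: "E \<le> q\<^sup>2 / (4 * (\<beta> + r))" "E \<le> q\<^sup>2 * \<kappa> / (16 * \<alpha>\<^sup>2)"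
    and \<theta>: "\<theta> \<le> q\<^sup>2 / (4 * (\<beta> + r))" "\<theta> \<le> q\<^sup>2 * \<kappa> / (16 * \<alpha>\<^sup>2)"
  shows "\<exists>y. g_fun np ap nu au \<kappa> y + r / 2 * (norm (y - x))\<^sup>2 \<le> - \<theta>"
proof -
  have \<alpha>: "1 / 2 \<le> \<alpha>" and \<beta>: "1 / 2 \<le> \<beta>"
    unfolding \<alpha>_def \<beta>_def by (rule alpha_const_ge beta_const_ge)+
  \<comment> \<open>The first bound makes the quadratic costs, \<beta>/2 and r/2 times
    \<open>t\<^sup>2\<close>, use up at most half of the linear gain \<open>q * t\<close>. The
    second gives t \<le> \<kappa> as \<alpha> \<ge> 1/2, so h drops by at most \<kappa>/2 and its
    absolute value remains h itself.\<close>
  define t where "t = min (q / (\<beta> + r)) (\<kappa> / (2 * \<alpha>))"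
  have t: "0 \<le> t" "t \<le> q / (\<beta> + r)" "t \<le> \<kappa> / (2 * \<alpha>)"
    unfolding t_def using assms(3-5) \<alpha> \<beta> by auto
  have "\<kappa> / (2 * \<alpha>) \<le> \<kappa> / 1"
    using \<alpha> \<open>0 < \<kappa>\<close> by (intro divide_left_mono) auto
  then have nonneg: "0 \<le> h_fun np ap nu au (x - t *\<^sub>R e)"
    using h_fun_drop_le[OF t(1), of x] h(1) t(3) by linarith
  have "(\<beta> + r) * t * t \<le> q * t"
    using t(1,2) \<beta> \<open>0 < r\<close> by (intro mult_right_mono) (auto simp: field_simps)
  then have quad: "\<beta> / 2 * t\<^sup>2 + r / 2 * t\<^sup>2 \<le> q * t / 2"
    by (simp add: power2_eq_square algebra_simps)
  have "t\<^sup>2 / 4 \<le> \<beta> / 2 * t\<^sup>2"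
    using mult_right_mono[OF \<beta>, of "t\<^sup>2"] by simp
  moreover have "q * t \<le> q_fun np ap nu au x * t"
    using assms t(1) by (intro mult_right_mono) auto
  ultimately have step: "h_fun np ap nu au (x - t *\<^sub>R e) + r / 2 * t\<^sup>2 \<le> \<kappa> + E - q * t / 2"
    using h_fun_descent[OF t(1), of x] h(2) quad by linarith
  \<comment> \<open>The remaining half of the gain must pay for the excess E of the constraint at x
    and for the margin \<theta>; each fits into \<open>q * t / 4\<close>.\<close>
  have "E + \<theta> \<le> q * t / 2"
  proof (cases "q / (\<beta> + r) \<le> \<kappa> / (2 * \<alpha>)")
    case True
    then have "q * t / 2 = q\<^sup>2 / (4 * (\<beta> + r)) + q\<^sup>2 / (4 * (\<beta> + r))"
      using \<beta> \<open>0 < r\<close> by (simp add: t_def power2_eq_square divide_simps)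
    then show ?thesis using E(1) \<theta>(1) by linarith
  next
    case False
    \<comment> \<open>Here t = \<kappa>/(2 \<alpha>), so the gain is linear in q while the
      hypotheses on E and \<theta> are quadratic; q \<le> 2 \<alpha> trades one factor q for
      \<alpha>.\<close>
    have "q \<le> 2 * \<alpha>"
      using assms(6) q_fun_le_half[of x] \<alpha> by linarith
    then have "q * (q * \<kappa>) / (16 * \<alpha>\<^sup>2) \<le> (2 * \<alpha>) * (q * \<kappa>) / (16 * \<alpha>\<^sup>2)"
      using assms(3,5) by (intro divide_right_mono mult_right_mono) auto
    also have "\<dots> = q * t / 4"
      using False \<alpha> by (simp add: t_def field_simps power2_eq_square)
    finally have "q\<^sup>2 * \<kappa> / (16 * \<alpha>\<^sup>2) \<le> q * t / 4"
      by (simp add: power2_eq_square mult.assoc)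
    then show ?thesis
      using E(2) \<theta>(2) by linarith
  qed
  then have "g_fun np ap nu au \<kappa> (x - t *\<^sub>R e) + r / 2 * (norm (x - t *\<^sub>R e - x))\<^sup>2 \<le> - \<theta>"
    using step nonneg norm_e by (simp add: g_fun_def)
  then show ?thesis by blast
qed

lemma uniform_slater:
  fixes kl ku \<kappa> r E \<theta> :: real
  defines "q \<equiv> q_inf np ap nu au \<kappa> kl ku"
    and "\<alpha> \<equiv> alpha_const np ap nu au" and "\<beta> \<equiv> beta_const np ap nu au"
  assumes gap: "K_gap np nu \<kappa> kl ku" and "0 < r"
    and E_le: "E \<le> Min {(ku - \<kappa>) / 2, q\<^sup>2 / (4 * (\<beta> + r)), q\<^sup>2 * \<kappa> / (16 * \<alpha>\<^sup>2)}"
    and \<theta>_le: "\<theta> \<le> Min {(\<kappa> - kl) / 2, q\<^sup>2 / (4 * (\<beta> + r)), q\<^sup>2 * \<kappa> / (16 * \<alpha>\<^sup>2)}"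
    and x: "g_fun np ap nu au \<kappa> x \<le> E"
  shows "\<exists>y. g_fun np ap nu au \<kappa> y + r / 2 * (norm (y - x))\<^sup>2 \<le> - \<theta>"
\<comment> \<open>Below the band the point x already has the margin
  \<open>(\<kappa> - kl) / 2\<close>, so y = x works.\<close>
proof (cases "\<bar>h_fun np ap nu au x\<bar> \<le> (\<kappa> + kl) / 2")
  case True
  have "\<theta> \<le> (\<kappa> - kl) / 2"
    using \<theta>_le by simp
  then have "g_fun np ap nu au \<kappa> x + r / 2 * (norm (x - x))\<^sup>2 \<le> - \<theta>"
    using True by (simp add: g_fun_def field_simps)
  then show ?thesis by blast
next
  case False
  have E: "E \<le> (ku - \<kappa>) / 2" "E \<le> q\<^sup>2 / (4 * (\<beta> + r))" "E \<le> q\<^sup>2 * \<kappa> / (16 * \<alpha>\<^sup>2)"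
    using E_le by simp_all
  have \<theta>: "\<theta> \<le> q\<^sup>2 / (4 * (\<beta> + r))" "\<theta> \<le> q\<^sup>2 * \<kappa> / (16 * \<alpha>\<^sup>2)"
    using \<theta>_le by simp_all
  have k: "kl < \<kappa>" "0 \<le> kl"
    using gap K_set_bounds unfolding K_gap_def by auto
  have h: "\<kappa> / 2 \<le> \<bar>h_fun np ap nu au x\<bar>" "\<bar>h_fun np ap nu au x\<bar> \<le> \<kappa> + E"
    using False k x by (auto simp: g_fun_def)
  \<comment> \<open>The first bound on E places x in the band over which \<open>q_inf\<close> is
    taken.\<close>
  have "\<bar>h_fun np ap nu au x\<bar> \<le> (\<kappa> + ku) / 2"
    using h(2) E(1) by argo
  then have q: "0 < q" "q \<le> q_fun np ap nu au x"
    unfolding q_def using q_inf_pos[OF gap] q_inf_le False by auto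
  note step = slater_step[OF _ \<open>0 < r\<close> q(1) _ _ _ E(2-3)[unfolded \<alpha>_def \<beta>_def] \<theta>[unfolded \<alpha>_def \<beta>_def]]
  show ?thesis
  proof (cases "0 \<le> h_fun np ap nu au x")
    case True
    then show ?thesis using step[of x] h q k by simp
  next
    case False
    \<comment> \<open>As h is odd and q is even, the step is made from \<open>- x\<close> and its
      result is reflected back.\<close>
    then obtain y where y: "g_fun np ap nu au \<kappa> y + r / 2 * (norm (y + x))\<^sup>2 \<le> - \<theta>"
      using step[of "- x"] h q k by (auto simp: h_fun_uminus[OF np nu] q_fun_uminus)
    have "norm (- y - x) = norm (y + x)"
      by (metis minus_add_distrib norm_minus_cancel uminus_add_conv_diff add.commute)
    then have "g_fun np ap nu au \<kappa> (- y) + r / 2 * (norm (- y - x))\<^sup>2 \<le> - \<theta>"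
      using y by (simp add: g_fun_def h_fun_uminus[OF np nu])
    then show ?thesis by blast
  qed
qed

end

text \<open>The range of \<kappa> reflects that K lies in [0, 1] and contains both ends, so that
  \<kappa> has an element of K on each side.\<close>

theorem theoremB1:
  fixes ap au :: "nat \<Rightarrow> real ^ 'd::{finite,linorder}"
    and np nu :: nat
    and \<kappa> lam :: real
  assumes "np \<ge> 1" and "nu \<ge> 1"
    and "0 \<le> \<kappa>" and "\<kappa> \<le> 1"
    and "\<And>i. i \<in> {1..np} \<Longrightarrow> first_coord (ap i) = 1"
    and "\<And>i. i \<in> {1..nu} \<Longrightarrow> first_coord (au i) = -1"
    and "\<kappa> \<notin> K_set np nu"
  shows "(\<exists>kl ku. K_gap np nu \<kappa> kl ku) \<and>
    (\<forall>kl ku. K_gap np nu \<kappa> kl ku \<longrightarrow>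
       q_inf np ap nu au \<kappa> kl ku > 0 \<and>
       (\<forall>rhobar epsbar \<theta> :: real.
          rhobar > rho_const np ap nu au lam \<longrightarrow>
          epsbar > 0 \<longrightarrow>
          epsbar\<^sup>2 \<le> Min {(ku - \<kappa>) / 2,
                          (q_inf np ap nu au \<kappa> kl ku)\<^sup>2 / (4 * (beta_const np ap nu au + rhobar)),
                          (q_inf np ap nu au \<kappa> kl ku)\<^sup>2 * \<kappa> / (16 * (alpha_const np ap nu au)\<^sup>2)} \<longrightarrow>
          \<theta> = Min {(\<kappa> - kl) / 2,
                   (q_inf np ap nu au \<kappa> kl ku)\<^sup>2 / (4 * (beta_const np ap nu au + rhobar)),
                   (q_inf np ap nu au \<kappa> kl ku)\<^sup>2 * \<kappa> / (16 * (alpha_const np ap nu au)\<^sup>2)} \<longrightarrow>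
          (\<forall>x. g_fun np ap nu au \<kappa> x \<le> epsbar\<^sup>2 \<longrightarrow>
             (\<exists>y. g_fun np ap nu au \<kappa> y + rhobar / 2 * (norm (y - x))\<^sup>2 \<le> - \<theta>))))"
proof -
  define e :: "real ^ 'd::{finite,linorder}" where "e = axis (Min UNIV) 1"
  have e: "norm e = 1" "\<And>v. e \<bullet> v = first_coord v"
    by (simp_all add: e_def first_coord_def inner_axis')
  have "\<forall>i\<in>{1..np}. e \<bullet> ap i = 1" "\<forall>i\<in>{1..nu}. e \<bullet> au i = -1"
    using assms(5,6) by (simp_all add: e(2))
  note ctx = assms(1,2) e(1) this
  \<comment> \<open>The maximum in \<open>rho_const\<close> is at least \<beta> \<ge> 1/2, whatever
    the sign of \<open>lam\<close>.\<close>
  have pos: "0 < rhobar" if "rhobar > rho_const np ap nu au lam" for rhobar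
    using that beta_const_ge[OF ctx] by (simp add: rho_const_def)
  show ?thesis
    by (intro conjI allI impI K_gap_exists[OF assms(1,3,4,7)] q_inf_pos[OF ctx] uniform_slater[OF ctx])
       (assumption | erule eq_refl pos)+
qed

end
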